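(* Let $k\ge 1$, let $P$ be an oriented path of length $n\ge 1$ (i.e.\ with $n$ edges), and let $l=l(P)$. Then, with $c_k=8^k\cdot k!$, $$n\cdot l^{k-1}\le \mathrm{RT}(P,k)\le c_k\cdot n\cdot l^{k-1}.$$
   Context: An oriented path is a path whose edges may be oriented arbitrarily, with no bidirected edges. The length of a path is its number of edges. For an oriented path $P$, $l(P)$ denotes the length of the longest directed subpath of $P$ (a subpath all of whose edges are oriented in the same direction along the path). A tournament is an oriented graph with exactly one edge between every pair of distinct vertices. A $k$-colouring is an edge-colouring with colours $\{1,\dots,k\}$. The $k$-colour oriented Ramsey number $\mathrm{RT}(H,k)$ is the least integer $N$ such that every $k$-coloured tournament on $N$ vertices contains a monochromatic copy (not necessarily induced subgraph isomorphic as a directed graph) of $H$. *)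

theory Defs
  imports Main
begin

text \<open>An oriented path of length n is encoded as a list P of n booleans:
  vertices are 0..n, and edge i (between vertex i and vertex i+1) is oriented
  forwards (i \<rightarrow> i+1) if P!i, and backwards (i+1 \<rightarrow> i) otherwise.\<close>

definition longest_dir :: "bool list \<Rightarrow> nat" where
  "longest_dir P = Max {m. \<exists>i. i + m \<le> length P \<and>
       (\<forall>j. i \<le> j \<and> j < i + m \<longrightarrow> P ! j = P ! i)}"

definition tournament :: "nat \<Rightarrow> (nat \<Rightarrow> nat \<Rightarrow> bool) \<Rightarrow> bool" where
  "tournament N T \<longleftrightarrow>
     (\<forall>x y. T x y \<longrightarrow> x < N \<and> y < N) \<and>
     (\<forall>x<N. \<not> T x x) \<and>
     (\<forall>x<N. \<forall>y<N. x \<noteq> y \<longrightarrow> (T x y \<longleftrightarrow> \<not> T y x))"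

definition k_colouring :: "nat \<Rightarrow> (nat \<Rightarrow> nat \<Rightarrow> bool) \<Rightarrow> (nat \<Rightarrow> nat \<Rightarrow> nat) \<Rightarrow> bool" where
  "k_colouring k T col \<longleftrightarrow> (\<forall>x y. T x y \<longrightarrow> col x y \<in> {1..k})"

definition mono_copy :: "nat \<Rightarrow> (nat \<Rightarrow> nat \<Rightarrow> bool) \<Rightarrow> (nat \<Rightarrow> nat \<Rightarrow> nat) \<Rightarrow> bool list \<Rightarrow> bool" where
  "mono_copy N T col P \<longleftrightarrow>
     (\<exists>v c. inj_on v {0..length P} \<and> v ` {0..length P} \<subseteq> {0..<N} \<and>
        (\<forall>i < length P.
           (if P ! i then T (v i) (v (Suc i)) \<and> col (v i) (v (Suc i)) = c
            else T (v (Suc i)) (v i) \<and> col (v (Suc i)) (v i) = c)))"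

definition RT :: "bool list \<Rightarrow> nat \<Rightarrow> nat" where
  "RT P k = (LEAST N. \<forall>T col. tournament N T \<and> k_colouring k T col \<longrightarrow> mono_copy N T col P)"

end

theory Submission
  imports Defs
begin

text \<open>
  Lower bound: order the vertices \<open>0, \<dots>, n * l ^ (k - 1) - 1\<close> transitively and colour a pair by the
  highest digit (in the mixed radix system \<open>n, l, l, \<dots>\<close>) in which the two differ. The colour of the
  lowest digit splits into components of size \<open>n\<close>; the other colours have no directed path of
  length \<open>l\<close>.

  Upper bound, by induction on \<open>k\<close>: let \<open>c\<close> be the most frequent colour. If there is a large set
  without edges of colour \<open>c\<close>, only \<open>k - 1\<close> colours are left on it. Otherwise, by the Gallai--Roy
  theorem, every moderately large set contains a directed path of colour \<open>c\<close> on \<open>l\<close> vertices.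
  Passing to a subgraph of large minimum degree of the bipartite double cover yields sets
  \<open>A\<close>, \<open>B\<close> such that every vertex of \<open>A\<close> has many out-neighbours in \<open>B\<close> and every vertex of \<open>B\<close> has many
  in-neighbours in \<open>A\<close> (of colour \<open>c\<close>). Now \<open>P\<close> is embedded greedily, one maximal directed segment
  at a time: a forward segment leaves a vertex of \<open>A\<close> and runs inside its unused out-neighbours
  in \<open>B\<close>, a backward segment leaves a vertex of \<open>B\<close> and runs inside its unused in-neighbours in \<open>A\<close>.
\<close>

section \<open>Directed paths and independent sets\<close>

text \<open>Each step to a supporting vertex lowers \<open>f\<close> by exactly one, so the walk
  ends after \<open>f v\<close> steps. The last conjunct provides distinctness in the
  induction.\<close>

lemma descending_path:
  assumes "\<forall>v\<in>W. f v > 0 \<longrightarrow> (\<exists>u\<in>W. R v u \<and> f v = Suc (f u))" and "v \<in> W"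
  shows "\<exists>ys. length ys = f v \<and> distinct (v # ys) \<and> set ys \<subseteq> W \<and> successively R (v # ys)
    \<and> (\<forall>y\<in>set ys. f y < f v)"
  using assms(2)
proof (induction "f v" arbitrary: v)
  case 0
  then show ?case by (intro exI[of _ "[]"]) auto
next
  case (Suc j)
  then obtain u where u: "u \<in> W" "R v u" "f v = Suc (f u)"
    using assms(1) by (metis zero_less_Suc)
  obtain ys where ys: "length ys = f u" "distinct (u # ys)" "set ys \<subseteq> W"
    "successively R (u # ys)" "\<forall>y\<in>set ys. f y < f u"
    using Suc.hyps(1)[of u] u Suc.hyps(2) by auto
  show ?case
    using u ys by (intro exI[of _ "u # ys"]) auto
qed

text \<open>Core of the Gallai--Roy theorem: descending paths bound supported functions by
  \<open>card W\<close>, so one of maximal sum exists, and an edge inside one of its levels would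
  allow a larger sum.\<close>

lemma independent_level_function:
  assumes "finite W"
  obtains f :: "'a \<Rightarrow> nat" where
    "\<forall>v\<in>W. f v > 0 \<longrightarrow> (\<exists>u\<in>W. R v u \<and> f v = Suc (f u))"
    "\<forall>u\<in>W. \<forall>v\<in>W. u \<noteq> v \<and> f u = f v \<longrightarrow> \<not> R u v"
proof -
  let ?supp = "\<lambda>f :: 'a \<Rightarrow> nat. \<forall>v\<in>W. f v > 0 \<longrightarrow> (\<exists>u\<in>W. R v u \<and> f v = Suc (f u))"
  have bound: "sum f W \<le> card W * card W" if f: "?supp f" for f
  proof -
    have "f v \<le> card W" if v: "v \<in> W" for v
    proof -
      obtain ys where ys: "length ys = f v" "distinct (v # ys)" "set ys \<subseteq> W"
        using descending_path[OF f v] by blast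
      then have "f v = card (set ys)"
        by (simp add: distinct_card)
      with ys assms show ?thesis by (simp add: card_mono)
    qed
    then show ?thesis using sum_bounded_above[of W f "card W"] by simp
  qed
  \<comment> \<open>The zero function is vacuously supported.\<close>
  have "\<exists>f. ?supp f \<and> (\<forall>g. ?supp g \<longrightarrow> sum g W \<le> sum f W)"
    by (rule ex_has_greatest_nat[where k = "\<lambda>_. 0" and b = "Suc (card W * card W)"])
      (use bound in \<open>auto simp: less_Suc_eq_le\<close>)
  then obtain f where f: "?supp f" and max: "\<And>g. ?supp g \<Longrightarrow> sum g W \<le> sum f W" by blast
  have "\<not> R u v" if uv: "u \<in> W" "v \<in> W" "u \<noteq> v" "f u = f v" for u v
  proof
    assume "R u v"
    define Q where "Q = {(w, w'). w \<in> W \<and> w' \<in> W \<and> R w w' \<and> f w = Suc (f w')}"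
    define S where "S = {w. (w, u) \<in> Q\<^sup>*}"
    \<comment> \<open>Raising the level of \<open>u\<close>, and of everything whose support may rest on \<open>u\<close>, contradicts maximality.\<close>
    define g where "g = (\<lambda>w. if w \<in> S then Suc (f w) else f w)"
    have uS: "u \<in> S" by (simp add: S_def)
    \<comment> \<open>Levels drop along \<open>Q\<close>, so \<open>v\<close>, on the same level as
      \<open>u\<close>, lies outside \<open>S\<close> and can support the raised
      \<open>u\<close>.\<close>
    have level: "w = u \<or> f w > f u" if "w \<in> S" for w
    proof -
      have "(w, u) \<in> Q\<^sup>*" using that by (simp add: S_def)
      then show ?thesis by (induction rule: converse_rtrancl_induct) (auto simp: Q_def)
    qed
    then have vS: "v \<notin> S" using uv by fastforce
    \<comment> \<open>Now \<open>u\<close> rests on \<open>v\<close>, any other member of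
      \<open>S\<close> on one that rises with it, and a vertex outside \<open>S\<close> on its old
      supporter, also outside \<open>S\<close>.\<close>
    have "\<exists>x\<in>W. R w x \<and> g w = Suc (g x)" if w: "w \<in> W" "g w > 0" for w
    proof (cases "w \<in> S")
      case wS: True
      show ?thesis
      proof (cases "w = u")
        case True
        then show ?thesis using uv \<open>R u v\<close> uS vS by (intro bexI[of _ v]) (auto simp: g_def)
      next
        case False
        then obtain x where "(w, x) \<in> Q" "(x, u) \<in> Q\<^sup>*"
          using wS unfolding S_def by (blast elim: converse_rtranclE)
        then show ?thesis
          using wS by (intro bexI[of _ x]) (auto simp: g_def Q_def S_def)
      qed
    next
      case False
      then obtain x where x: "x \<in> W" "R w x" "f w = Suc (f x)"
        using f w by (auto simp: g_def)
      then have "(w, x) \<in> Q" using w by (simp add: Q_def)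
      then have "x \<notin> S" using False by (auto simp: S_def intro: converse_rtrancl_into_rtrancl)
      then show ?thesis using x False by (auto simp: g_def)
    qed
    then have "sum g W \<le> sum f W" by (intro max) blast
    moreover have "sum f W < sum g W"
      by (rule sum_strict_mono_ex1) (use assms uv uS in \<open>auto simp: g_def\<close>)
    ultimately show False by simp
  qed
  then show thesis using that f by blast
qed

text \<open>Levels are independent, so those below \<open>q - 1\<close> hold at most
  \<open>s * (q - 1)\<close> vertices. Some vertex thus has level at least \<open>q - 1\<close> and
  starts a descending path on at least \<open>q\<close> vertices.\<close>

lemma gallai_roy:
  assumes "finite W" and "q \<ge> 1" and "s * (q - 1) < card W"
    and indep: "\<And>I. I \<subseteq> W \<Longrightarrow> \<forall>x\<in>I. \<forall>y\<in>I. x \<noteq> y \<longrightarrow> \<not> R x y \<Longrightarrow> card I \<le> s"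
  shows "\<exists>ys. length ys = q \<and> distinct ys \<and> set ys \<subseteq> W \<and> successively R ys"
proof -
  obtain f :: "'a \<Rightarrow> nat" where
    f: "\<forall>v\<in>W. f v > 0 \<longrightarrow> (\<exists>u\<in>W. R v u \<and> f v = Suc (f u))"
    "\<forall>u\<in>W. \<forall>v\<in>W. u \<noteq> v \<and> f u = f v \<longrightarrow> \<not> R u v"
    using independent_level_function[OF assms(1)] by blast
  have "\<exists>v\<in>W. f v \<ge> q - 1"
  proof (rule ccontr)
    assume "\<not> ?thesis"
    then have "W \<subseteq> (\<Union>j<q - 1. {v\<in>W. f v = j})" by auto
    then have "card W \<le> card (\<Union>j<q - 1. {v\<in>W. f v = j})"
      using assms(1) by (intro card_mono) auto
    also have "\<dots> \<le> (\<Sum>j<q - 1. card {v\<in>W. f v = j})"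
      by (rule card_UN_le) simp
    also have "\<dots> \<le> (\<Sum>j<q - 1. s)"
      by (intro sum_mono indep) (use f in auto)
    finally show False using assms by (simp add: mult.commute)
  qed
  then obtain v where v: "v \<in> W" "f v \<ge> q - 1" by blast
  obtain ys where ys: "length ys = f v" "distinct (v # ys)" "set ys \<subseteq> W" "successively R (v # ys)"
    using descending_path[OF f(1) v(1)] by blast
  have "v # ys = take q (v # ys) @ drop q (v # ys)" by simp
  then have "successively R (take q (v # ys))"
    using ys(4) by (metis successively_append_iff)
  moreover have "length (take q (v # ys)) = q" using ys v assms by simp
  moreover have "distinct (take q (v # ys))" using ys by (metis distinct_take)
  moreover have "set (take q (v # ys)) \<subseteq> W"
    using ys v set_take_subset[of q "v # ys"] by auto
  ultimately show ?thesis by blast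
qed

section \<open>Subgraphs of large minimum degree\<close>

text \<open>Deleting a vertex of degree at most \<open>d\<close> loses at most \<open>d\<close>
  edges and lowers the left-hand side by \<open>d\<close>, so the inequality survives. The sides may
  overlap: the application has \<open>A = B\<close>, as in a double cover.\<close>

lemma min_degree_subgraph:
  assumes "finite A" "finite B" and "(card A + card B) * d < card (E \<inter> A \<times> B)"
  shows "\<exists>A' B'. A' \<subseteq> A \<and> B' \<subseteq> B \<and> A' \<noteq> {} \<and> B' \<noteq> {} \<and>
    (\<forall>a\<in>A'. d < card {b\<in>B'. (a, b) \<in> E}) \<and> (\<forall>b\<in>B'. d < card {a\<in>A'. (a, b) \<in> E})"
  using assms
proof (induction "card A + card B" arbitrary: A B rule: less_induct)
  case less
  show ?case
  proof (cases "(\<forall>a\<in>A. d < card {b\<in>B. (a, b) \<in> E}) \<and> (\<forall>b\<in>B. d < card {a\<in>A. (a, b) \<in> E})")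
    case True
    have "E \<inter> A \<times> B \<noteq> {}" using less.prems(3) by force
    then show ?thesis using True by (intro exI[of _ A] exI[of _ B]) auto
  next
    case False
    then consider a where "a \<in> A" "card {b\<in>B. (a, b) \<in> E} \<le> d"
      | b where "b \<in> B" "card {a\<in>A. (a, b) \<in> E} \<le> d"
      by (meson not_le)
    then show ?thesis
    proof cases
      case 1
      have "E \<inter> A \<times> B \<subseteq> (E \<inter> (A - {a}) \<times> B) \<union> Pair a ` {b\<in>B. (a, b) \<in> E}" by auto
      then have "card (E \<inter> A \<times> B) \<le> card ((E \<inter> (A - {a}) \<times> B) \<union> Pair a ` {b\<in>B. (a, b) \<in> E})"
        using less.prems by (intro card_mono) auto
      also have "\<dots> \<le> card (E \<inter> (A - {a}) \<times> B) + card (Pair a ` {b\<in>B. (a, b) \<in> E})"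
        by (rule card_Un_le)
      also have "\<dots> \<le> card (E \<inter> (A - {a}) \<times> B) + d"
        using 1 by (simp add: card_image inj_on_def)
      finally have le: "card (E \<inter> A \<times> B) \<le> card (E \<inter> (A - {a}) \<times> B) + d" .
      have c: "card A = Suc (card (A - {a}))" using 1 less.prems by (metis card_Suc_Diff1)
      have "(card (A - {a}) + card B) * d < card (E \<inter> (A - {a}) \<times> B)"
        using le less.prems(3) unfolding c by (simp add: algebra_simps)
      from less.hyps[OF _ _ _ this] show ?thesis
        using less.prems c by (simp add: subset_Diff_insert) blast
    next
      case 2
      have "E \<inter> A \<times> B \<subseteq> (E \<inter> A \<times> (B - {b})) \<union> (\<lambda>a. (a, b)) ` {a\<in>A. (a, b) \<in> E}" by auto
      then have "card (E \<inter> A \<times> B) \<le> card ((E \<inter> A \<times> (B - {b})) \<union> (\<lambda>a. (a, b)) ` {a\<in>A. (a, b) \<in> E})"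
        using less.prems by (intro card_mono) auto
      also have "\<dots> \<le> card (E \<inter> A \<times> (B - {b})) + card ((\<lambda>a. (a, b)) ` {a\<in>A. (a, b) \<in> E})"
        by (rule card_Un_le)
      also have "\<dots> \<le> card (E \<inter> A \<times> (B - {b})) + d"
        using 2 by (simp add: card_image inj_on_def)
      finally have le: "card (E \<inter> A \<times> B) \<le> card (E \<inter> A \<times> (B - {b})) + d" .
      have c: "card B = Suc (card (B - {b}))" using 2 less.prems by (metis card_Suc_Diff1)
      have "(card A + card (B - {b})) * d < card (E \<inter> A \<times> (B - {b}))"
        using le less.prems(3) unfolding c by (simp add: algebra_simps)
      from less.hyps[OF _ _ _ this] show ?thesis
        using less.prems c by (simp add: subset_Diff_insert) blast
    qed
  qed
qed

section \<open>Embedding an oriented path\<close>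

definition edge_dir :: "('a \<Rightarrow> 'a \<Rightarrow> bool) \<Rightarrow> bool \<Rightarrow> 'a \<Rightarrow> 'a \<Rightarrow> bool" where
  "edge_dir G b x y = (if b then G x y else G y x)"

text \<open>The start is kept apart from the list, which then has one entry per edge; consecutive
  segments share their junction without repeating it.\<close>

fun follows :: "('a \<Rightarrow> 'a \<Rightarrow> bool) \<Rightarrow> 'a \<Rightarrow> bool list \<Rightarrow> 'a list \<Rightarrow> bool" where
  "follows G x [] [] \<longleftrightarrow> True"
| "follows G x (p # P) (y # ys) \<longleftrightarrow> edge_dir G p x y \<and> follows G y P ys"
| "follows G x _ _ \<longleftrightarrow> False"

lemma follows_append:
  assumes "length P = length xs"
  shows "follows G x (P @ Q) (xs @ ys) \<longleftrightarrow> follows G x P xs \<and> follows G (last (x # xs)) Q ys"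
  using assms by (induction P xs arbitrary: x rule: list_induct2) auto

lemma follows_replicate:
  "follows G x (replicate (length ys) b) ys \<longleftrightarrow> successively (edge_dir G b) (x # ys)"
  by (induction ys arbitrary: x) auto

lemma follows_nth:
  assumes "follows G x P ys" and "i < length P"
  shows "edge_dir G (P ! i) ((x # ys) ! i) ((x # ys) ! Suc i)"
  using assms
proof (induction G x P ys arbitrary: i rule: follows.induct)
  case (2 G x p P y ys)
  then show ?case by (cases i) auto
qed auto

text \<open>Induction over maximal runs: a run of direction \<open>b\<close> starts in
  \<open>D b\<close> and ends in \<open>D (\<not> b)\<close>, where the next run starts.
  \<open>S\<close> collects the used vertices.\<close>

lemma follows_greedy:
  assumes extend: "\<And>b x S q. x \<in> D b \<Longrightarrow> finite S \<Longrightarrow> card S \<le> n \<Longrightarrow> 1 \<le> q \<Longrightarrow> q \<le> l \<Longrightarrow>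
      \<exists>vs. length vs = q \<and> distinct vs \<and> set vs \<subseteq> D (\<not> b) - S \<and> follows G x (replicate q b) vs"
    and runs: "\<And>xs q b ys. P = xs @ replicate q b @ ys \<Longrightarrow> q \<le> l"
    and "finite S" "card S + length P \<le> Suc n" "P \<noteq> [] \<Longrightarrow> x \<in> D (hd P)"
  shows "\<exists>ys. length ys = length P \<and> distinct ys \<and> set ys \<inter> S = {} \<and> set ys \<subseteq> D True \<union> D False
    \<and> follows G x P ys"
  using runs assms(3-)
proof (induction P arbitrary: x S rule: length_induct)
  case (1 P)
  show ?case
  proof (cases "P = []")
    case False
    define p where "p = hd P"
    define q where "q = length (takeWhile ((=) p) P)"
    define Q where "Q = dropWhile ((=) p) P"
    have "takeWhile ((=) p) P = replicate q p"
      unfolding q_def by (rule replicate_eqI) (auto dest: set_takeWhileD)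
    then have P: "P = replicate q p @ Q"
      unfolding Q_def by (metis takeWhile_dropWhile_id)
    have q1: "1 \<le> q" using False by (cases P) (auto simp: q_def p_def)
    have ql: "q \<le> l" using "1.prems"(1)[of "[]" q p Q] P by simp
    \<comment> \<open>By maximality of the run the direction flips here, so \<open>last vs\<close>
      lies in the set required for \<open>Q\<close>.\<close>
    have Q: "hd Q = (\<not> p)" if "Q \<noteq> []"
      using that hd_dropWhile[of "(=) p" P] by (auto simp: Q_def)
    have len: "length P = q + length Q" by (subst P) simp
    \<comment> \<open>As \<open>P\<close> is nonempty, the vertex budget \<open>Suc n\<close> leaves
      \<open>card S \<le> n\<close>.\<close>
    obtain vs where vs: "length vs = q" "distinct vs" "set vs \<subseteq> D (\<not> p) - S"
      "follows G x (replicate q p) vs"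
      using extend[of x p S q] "1.prems" False q1 ql len p_def by auto
    have "last vs \<in> D (\<not> p)" using vs q1 by (metis Diff_iff last_in_set length_0_conv not_one_le_zero subsetD)
    have "card (S \<union> set vs) \<le> card S + q"
      using card_Un_le[of S "set vs"] vs by (metis distinct_card)
    then have "card (S \<union> set vs) + length Q \<le> Suc n" using "1.prems" len by simp
    moreover have "length Q < length P" using len q1 by simp
    moreover have "r \<le> l" if "Q = xs @ replicate r b @ ys" for xs r b ys
      using "1.prems"(1)[of "replicate q p @ xs" r b ys] P that by simp
    ultimately obtain ys where ys: "length ys = length Q" "distinct ys" "set ys \<inter> (S \<union> set vs) = {}"
      "set ys \<subseteq> D True \<union> D False" "follows G (last vs) Q ys"
      using "1.IH"[rule_format, of Q "S \<union> set vs" "last vs"] "1.prems"(2) \<open>last vs \<in> _\<close> Q by auto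
    have "D (\<not> p) \<subseteq> D True \<union> D False" by (cases p) auto
    moreover have "follows G x P (vs @ ys)"
      unfolding P using vs ys q1 by (subst follows_append) auto
    ultimately show ?thesis
      using vs ys len by (intro exI[of _ "vs @ ys"]) auto
  qed auto
qed

section \<open>The upper bound\<close>

lemma card_edges_semicomplete:
  assumes "finite V" and "\<And>x y. x \<in> V \<Longrightarrow> y \<in> V \<Longrightarrow> x \<noteq> y \<Longrightarrow> T x y \<or> T y x"
  shows "card V * (card V - 1) \<le> 2 * card {(x, y). x \<in> V \<and> y \<in> V \<and> T x y}"
proof -
  let ?X = "{(x, y). x \<in> V \<and> y \<in> V \<and> T x y}"
  have fin: "finite ?X" by (rule finite_subset[of _ "V \<times> V"]) (use assms in auto)
  have "V \<times> V \<subseteq> ?X \<union> prod.swap ` ?X \<union> (\<lambda>x. (x, x)) ` V"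
    using assms(2) by (force simp: image_iff)
  then have "card (V \<times> V) \<le> card (?X \<union> prod.swap ` ?X \<union> (\<lambda>x. (x, x)) ` V)"
    using fin assms by (intro card_mono) auto
  also have "\<dots> \<le> card ?X + card (prod.swap ` ?X) + card ((\<lambda>x. (x, x)) ` V)"
    by (meson add_le_mono1 card_Un_le order_trans)
  also have "\<dots> \<le> card ?X + card ?X + card V"
    by (intro add_mono card_image_le fin assms order_refl)
  finally show ?thesis by (simp add: card_cartesian_product diff_mult_distrib2)
qed

lemma frequent_colour:
  assumes "finite X" "finite C" "col ` X \<subseteq> C" "C \<noteq> {}"
  shows "\<exists>c\<in>C. card X \<le> card C * card {e\<in>X. col e = c}"
proof (rule ccontr)
  assume "\<not> ?thesis"
  then have less: "card C * card {e\<in>X. col e = c} < card X" if "c \<in> C" for c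
    using that by (meson not_le)
  have "X \<subseteq> (\<Union>c\<in>C. {e\<in>X. col e = c})" using assms by auto
  then have "card X \<le> card (\<Union>c\<in>C. {e\<in>X. col e = c})"
    using assms by (intro card_mono) auto
  also have "\<dots> \<le> (\<Sum>c\<in>C. card {e\<in>X. col e = c})"
    by (rule card_UN_le[OF assms(2)])
  finally have "card C * card X \<le> (\<Sum>c\<in>C. card C * card {e\<in>X. col e = c})"
    by (simp flip: sum_distrib_left)
  also have "\<dots> < (\<Sum>c\<in>C. card X)"
    by (rule sum_strict_mono) (use assms less in auto)
  finally show False by simp
qed

text \<open>\<open>\<delta>\<close> is the minimum degree to be reached: after removing at most
  \<open>length P\<close> used vertices, a neighbourhood keeps more than \<open>s * (l - 1)\<close>,
  enough for Gallai--Roy to give a path on \<open>l\<close> vertices.\<close>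

lemma mono_path_or_independent:
  fixes col :: "'a \<Rightarrow> 'a \<Rightarrow> 'c"
  assumes "finite V" "finite C" "card C = k" "k \<ge> 1" "card V = 4 * k * \<delta>"
    and complete: "\<And>x y. x \<in> V \<Longrightarrow> y \<in> V \<Longrightarrow> x \<noteq> y \<Longrightarrow> T x y \<or> T y x"
    and col: "\<And>x y. x \<in> V \<Longrightarrow> y \<in> V \<Longrightarrow> T x y \<Longrightarrow> col x y \<in> C"
    and runs: "\<And>xs q b ys. P = xs @ replicate q b @ ys \<Longrightarrow> q \<le> l"
    and \<delta>: "length P + s * (l - 1) < \<delta>"
    and indep: "\<And>c I. c \<in> C \<Longrightarrow> I \<subseteq> V \<Longrightarrow> 
      \<forall>x\<in>I. \<forall>y\<in>I. x \<noteq> y \<longrightarrow> \<not> (T x y \<and> col x y = c) \<Longrightarrow> card I \<le> s"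
  shows "\<exists>c\<in>C. \<exists>x ys. length ys = length P \<and> distinct (x # ys) \<and> set (x # ys) \<subseteq> V
    \<and> follows (\<lambda>x y. T x y \<and> col x y = c) x P ys"
proof -
  let ?X = "{(x, y). x \<in> V \<and> y \<in> V \<and> T x y}"
  have finX: "finite ?X" by (rule finite_subset[of _ "V \<times> V"]) (use assms in auto)
  have "(\<lambda>(x, y). col x y) ` ?X \<subseteq> C" "C \<noteq> {}" using col assms by auto
  from frequent_colour[OF finX assms(2) this] obtain c where c: "c \<in> C" "card ?X \<le> k * card {e\<in>?X. (\<lambda>(x, y). col x y) e = c}"
    unfolding assms(3) by blast
  define G where "G = (\<lambda>x y. T x y \<and> col x y = c)"
  define E where "E = {(x, y). x \<in> V \<and> y \<in> V \<and> G x y}"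
  have "{e\<in>?X. (\<lambda>(x, y). col x y) e = c} = E" by (auto simp: E_def G_def)
  then have "card V * (card V - 1) \<le> 2 * (k * card E)"
    using card_edges_semicomplete[of V T] assms(1) complete c by fastforce
  \<comment> \<open>The factor \<open>4 * k\<close> collects \<open>k\<close> colours, a 2 for
    unordered pairs and a 2 for the two copies of \<open>V\<close>.\<close>
  moreover have "4 * k * (\<delta> - 1) < card V - 1"
    using \<delta> assms(4,5) by (cases \<delta>) auto
  moreover have "0 < card V" using assms(4,5) \<delta> by simp
  ultimately have "card V * (4 * k * (\<delta> - 1)) < 2 * (k * card E)"
    by (metis mult_less_mono2 order_less_le_trans)
  then have "k * (2 * ((card V + card V) * (\<delta> - 1))) < k * (2 * card E)"
    by (simp add: algebra_simps)
  moreover have "E \<inter> V \<times> V = E" by (auto simp: E_def)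
  ultimately have "(card V + card V) * (\<delta> - 1) < card (E \<inter> V \<times> V)" by simp
  from min_degree_subgraph[OF assms(1) assms(1) this] obtain A B where
    AB: "A \<subseteq> V" "B \<subseteq> V" "A \<noteq> {}" "B \<noteq> {}"
    "\<forall>a\<in>A. \<delta> - 1 < card {b\<in>B. (a, b) \<in> E}" "\<forall>b\<in>B. \<delta> - 1 < card {a\<in>A. (a, b) \<in> E}" by blast
  define D where "D = (\<lambda>b. if b then A else B)"
  have DV: "D b \<subseteq> V" for b using AB by (simp add: D_def)
  have deg: "\<delta> \<le> card {y \<in> D (\<not> b). edge_dir G b x y}" if x: "x \<in> D b" for b x
  proof (cases b)
    case True
    then have "{y \<in> D (\<not> b). edge_dir G b x y} = {y\<in>B. (x, y) \<in> E}"
      using x AB by (auto simp: D_def E_def edge_dir_def)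
    then show ?thesis using AB(5) x True by (auto simp: D_def)
  next
    case False
    then have "{y \<in> D (\<not> b). edge_dir G b x y} = {y\<in>A. (y, x) \<in> E}"
      using x AB by (auto simp: D_def E_def edge_dir_def)
    then show ?thesis using AB(6) x False by (auto simp: D_def)
  qed
  have extend: "\<exists>vs. length vs = q \<and> distinct vs \<and> set vs \<subseteq> D (\<not> b) - S \<and> follows G x (replicate q b) vs"
    if S: "x \<in> D b" "finite S" "card S \<le> length P" "1 \<le> q" "q \<le> l" for b x S q
  proof -
    define W where "W = {y \<in> D (\<not> b). edge_dir G b x y} - S"
    have WV: "W \<subseteq> V" using DV by (auto simp: W_def)
    then have "finite W" using assms(1) finite_subset by blast
    have "\<delta> - card S \<le> card W"
      using deg[OF S(1)] diff_card_le_card_Diff[OF S(2)] unfolding W_def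
      by (meson diff_le_mono order_trans)
    moreover have "s * (q - 1) \<le> s * (l - 1)"
      using S by (intro mult_le_mono2 diff_le_mono)
    ultimately have "s * (q - 1) < card W" using \<delta> S(3) by linarith
    \<comment> \<open>Independence is symmetric in the pair, so the bound \<open>s\<close> also
      serves backward runs.\<close>
    moreover have "card I \<le> s" if I: "I \<subseteq> W" "\<forall>x\<in>I. \<forall>y\<in>I. x \<noteq> y \<longrightarrow> \<not> edge_dir G b x y" for I
    proof (rule indep[OF c(1)])
      show "\<forall>x\<in>I. \<forall>y\<in>I. x \<noteq> y \<longrightarrow> \<not> (T x y \<and> col x y = c)"
        using I(2) by (cases b) (auto simp: edge_dir_def G_def)
    qed (use I WV in auto)
    ultimately obtain vs where vs: "length vs = q" "distinct vs" "set vs \<subseteq> W"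
      "successively (edge_dir G b) vs"
      using gallai_roy[OF \<open>finite W\<close> S(4)] by blast
    then have "successively (edge_dir G b) (x # vs)"
      using S(4) by (cases vs) (auto simp: W_def)
    then have "follows G x (replicate q b) vs" using vs follows_replicate by metis
    then show ?thesis using vs by (auto simp: W_def)
  qed
  have "D (hd P) \<noteq> {}" using AB by (simp add: D_def)
  then obtain x where x: "x \<in> D (hd P)" by blast
  obtain ys where "length ys = length P" "distinct ys" "set ys \<inter> {x} = {}"
    "set ys \<subseteq> D True \<union> D False" "follows G x P ys"
    using follows_greedy[of D "length P" l G P "{x}" x] extend runs x by force
  then show ?thesis
    using c(1) x DV unfolding G_def by (intro bexI[of _ c] exI[of _ x] exI[of _ ys]) auto
qed

text \<open>Induction on the number of colours \<open>Suc k\<close>. Vertex and colour sets are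
  arbitrary finite sets so that the induction can pass to \<open>I\<close> and
  \<open>C - {c}\<close>.\<close>

lemma mono_path:
  fixes col :: "'a \<Rightarrow> 'a \<Rightarrow> 'c"
  assumes "length P = n" "1 \<le> l" "l \<le> n"
    and runs: "\<And>xs q b ys. P = xs @ replicate q b @ ys \<Longrightarrow> q \<le> l"
    and "finite V" "finite C" "card C = Suc k" "8 ^ Suc k * fact (Suc k) * n * l ^ k \<le> card V"
    and "\<And>x y. x \<in> V \<Longrightarrow> y \<in> V \<Longrightarrow> x \<noteq> y \<Longrightarrow> T x y \<or> T y x"
    and "\<And>x. x \<in> V \<Longrightarrow> \<not> T x x"
    and "\<And>x y. x \<in> V \<Longrightarrow> y \<in> V \<Longrightarrow> T x y \<Longrightarrow> col x y \<in> C"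
  shows "\<exists>c\<in>C. \<exists>x ys. length ys = length P \<and> distinct (x # ys) \<and> set (x # ys) \<subseteq> V
    \<and> follows (\<lambda>x y. T x y \<and> col x y = c) x P ys"
  using assms(5-)
proof (induction k arbitrary: V C)
  case 0
  \<comment> \<open>Here \<open>\<delta> = 2 * n\<close> and \<open>s = 1\<close>: with one colour
    all pairs are joined in it, and \<open>n + (l - 1) < 2 * n\<close>.\<close>
  then have "4 * 1 * (2 * n) \<le> card V" by simp
  then obtain V' where V': "V' \<subseteq> V" "finite V'" "card V' = 4 * 1 * (2 * n)"
    by (metis obtain_subset_with_card_n)
  have "\<exists>c\<in>C. \<exists>x ys. length ys = length P \<and> distinct (x # ys) \<and> set (x # ys) \<subseteq> V'
    \<and> follows (\<lambda>x y. T x y \<and> col x y = c) x P ys"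
  proof (rule mono_path_or_independent[where s = 1 and l = l, OF V'(2) 0(2) _ _ V'(3)])
    fix c I
    assume I: "c \<in> C" "I \<subseteq> V'" "\<forall>x\<in>I. \<forall>y\<in>I. x \<noteq> y \<longrightarrow> \<not> (T x y \<and> col x y = c)"
    have "C = {c}" using 0 I(1) by (metis One_nat_def card_1_singletonE singletonD)
    have "x = y" if "x \<in> I" "y \<in> I" for x y
    proof (rule ccontr)
      assume "x \<noteq> y"
      moreover have "x \<in> V" "y \<in> V" using that I V' by auto
      ultimately consider "T x y" "col x y = c" | "T y x" "col y x = c"
        using 0(5,7) \<open>C = {c}\<close> by blast
      then show False using I(3) that \<open>x \<noteq> y\<close> by cases auto
    qed
    then have "I = {} \<or> (\<exists>x. I = {x})" by blast
    then show "card I \<le> 1" by auto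
  qed (use 0 V' assms(1-3) runs in \<open>auto simp: subset_iff\<close>)
  then show ?case using V' by blast
next
  case (Suc k)
  define s where "s = 8 ^ Suc k * fact (Suc k) * n * l ^ k"
  have s: "n \<le> s" "1 \<le> s" using assms(2,3) by (auto simp: s_def Suc_le_eq simp del: fact_Suc)
  \<comment> \<open>With \<open>s\<close> the bound for one colour fewer, an extra factor 8 times
    the number of colours times \<open>l\<close> gives \<open>\<delta> = 2 * s * l\<close>.\<close>
  have "8 ^ Suc (Suc k) * fact (Suc (Suc k)) * n * l ^ Suc k = 4 * Suc (Suc k) * (2 * s * l)"
    by (simp add: s_def algebra_simps)
  then obtain V' where V': "V' \<subseteq> V" "finite V'" "card V' = 4 * Suc (Suc k) * (2 * s * l)"
    using Suc.prems by (metis obtain_subset_with_card_n)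
  show ?case
  proof (cases "\<exists>c I. c \<in> C \<and> I \<subseteq> V' \<and> (\<forall>x\<in>I. \<forall>y\<in>I. x \<noteq> y \<longrightarrow> \<not> (T x y \<and> col x y = c)) \<and> s < card I")
    case True
    then obtain c I where I: "c \<in> C" "I \<subseteq> V'" "s < card I"
      "\<forall>x\<in>I. \<forall>y\<in>I. x \<noteq> y \<longrightarrow> \<not> (T x y \<and> col x y = c)" by blast
    have "finite I" using I V' finite_subset by blast
    moreover have "card (C - {c}) = Suc k" using Suc.prems I by simp
    moreover have "I \<subseteq> V" using I V' by simp
    moreover have "col x y \<in> C - {c}" if xy: "x \<in> I" "y \<in> I" "T x y" for x y
    proof -
      have V: "x \<in> V" "y \<in> V" using \<open>I \<subseteq> V\<close> xy by auto
      \<comment> \<open>The independence of \<open>I\<close> concerns distinct vertices only; loops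
        are excluded by irreflexivity.\<close>
      then have "x \<noteq> y" using Suc.prems(6) xy(3) by metis
      then show ?thesis using Suc.prems(7)[OF V xy(3)] I(4) xy by auto
    qed
    moreover have "T x y \<or> T y x" if "x \<in> I" "y \<in> I" "x \<noteq> y" for x y
      using Suc.prems(5) \<open>I \<subseteq> V\<close> that by (meson subsetD)
    moreover have "\<not> T x x" if "x \<in> I" for x
      using Suc.prems(6) \<open>I \<subseteq> V\<close> that by (meson subsetD)
    moreover have "8 ^ Suc k * fact (Suc k) * n * l ^ k \<le> card I"
      using I(3) unfolding s_def by (rule less_imp_le)
    ultimately have "\<exists>c'\<in>C - {c}. \<exists>x ys. length ys = length P \<and> distinct (x # ys) \<and> set (x # ys) \<subseteq> I
      \<and> follows (\<lambda>x y. T x y \<and> col x y = c') x P ys"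
      using Suc.prems(2) by (intro Suc.IH) blast+
    then show ?thesis using \<open>I \<subseteq> V\<close> by blast
  next
    case False
    have "\<exists>c\<in>C. \<exists>x ys. length ys = length P \<and> distinct (x # ys) \<and> set (x # ys) \<subseteq> V'
      \<and> follows (\<lambda>x y. T x y \<and> col x y = c) x P ys"
    proof (rule mono_path_or_independent[where s = s and l = l, OF V'(2) Suc.prems(2) _ _ V'(3)])
      \<comment> \<open>From \<open>n \<le> s\<close> the left side is at most
        \<open>s * l\<close>.\<close>
      have "n + s * (l - 1) < 2 * s * l"
        using s assms(2) by (cases l) (auto simp: algebra_simps)
      then show "length P + s * (l - 1) < 2 * s * l" using assms(1) by simp
      show "card I \<le> s" if "c \<in> C" "I \<subseteq> V'"
        "\<forall>x\<in>I. \<forall>y\<in>I. x \<noteq> y \<longrightarrow> \<not> (T x y \<and> col x y = c)" for c I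
        using False that not_less by metis
    qed (use Suc.prems V' runs in \<open>auto simp: subset_iff\<close>)
    then show ?thesis using V' by blast
  qed
qed

section \<open>The longest directed segment\<close>

lemma longest_dir_set_finite:
  "finite {m. \<exists>i. i + m \<le> length P \<and> (\<forall>j. i \<le> j \<and> j < i + m \<longrightarrow> P ! j = P ! i)}"
  by (rule finite_subset[of _ "{..length P}"]) auto

lemma run_le_longest_dir: "q \<le> longest_dir (xs @ replicate q b @ ys)"
  unfolding longest_dir_def
  by (rule Max_ge[OF longest_dir_set_finite]) (auto simp: nth_append intro!: exI[of _ "length xs"])

lemma longest_dir_attained:
  "\<exists>i. i + longest_dir P \<le> length P \<and> (\<forall>j. i \<le> j \<and> j < i + longest_dir P \<longrightarrow> P ! j = P ! i)"
proof -
  let ?S = "{m. \<exists>i. i + m \<le> length P \<and> (\<forall>j. i \<le> j \<and> j < i + m \<longrightarrow> P ! j = P ! i)}"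
  have "0 \<in> ?S" by auto
  then have "Max ?S \<in> ?S" using Max_in[OF longest_dir_set_finite] by blast
  then show ?thesis unfolding longest_dir_def by blast
qed

lemma longest_dir_pos:
  assumes "P \<noteq> []"
  shows "1 \<le> longest_dir P"
  using run_le_longest_dir[of 1 "[]" "hd P" "tl P"] assms by simp

section \<open>The lower bound\<close>

text \<open>After \<open>l\<close> strict increases \<open>g\<close> has grown by at least
  \<open>l\<close>, which changes its quotient by \<open>l\<close>.\<close>

lemma digit_bound:
  fixes g :: "nat \<Rightarrow> nat"
  assumes "\<And>t. t < l \<Longrightarrow> g t < g (Suc t)" and "\<And>t. t < l \<Longrightarrow> g t div l = g (Suc t) div l" and "l \<ge> 1"
  shows False
proof -
  have "t \<le> l \<Longrightarrow> g 0 + t \<le> g t \<and> g t div l = g 0 div l" for t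
  proof (induction t)
    case (Suc t)
    then show ?case using assms(1,2)[of t] by simp
  qed simp
  from this[of l] have "g 0 + l \<le> g l" "g l div l = g 0 div l" by auto
  then have "(g 0 + l) div l \<le> g 0 div l" by (metis div_le_mono)
  then show False using assms(3) by (simp add: div_add_self2)
qed

text \<open>Every \<open>N\<close> up to the bound is treated, because the least \<open>N\<close>
  forcing a copy must be excluded from the whole range.\<close>

lemma digit_colouring_no_copy:
  assumes "length P = n" "n \<ge> 1" "l = longest_dir P" "k \<ge> 1" "N \<le> n * l ^ (k - 1)"
  shows "\<exists>T col. tournament N T \<and> k_colouring k T col \<and> \<not> mono_copy N T col P"
proof -
  have l1: "1 \<le> l" using assms longest_dir_pos[of P] by fastforce
  define T where "T = (\<lambda>x y. x < y \<and> y < N)"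
  \<comment> \<open>\<open>d x j\<close> drops digits 0 to \<open>j\<close>, so for distinct
    vertices \<open>h\<close> is the highest differing digit; \<open>Suc\<close> makes colours start
    at 1.\<close>
  define d where "d = (\<lambda>x j. x div (n * l ^ j))"
  define h where "h = (\<lambda>x y. LEAST j. d x j = d y j)"
  define col where "col = (\<lambda>x y. Suc (h x y))"
  \<comment> \<open>Dropping \<open>k\<close> digits leaves 0, so the \<open>LEAST\<close> exists
    and \<open>k\<close> colours suffice.\<close>
  have top: "d x (k - 1) = 0" if "x < N" for x
    using that assms by (simp add: d_def)
  have h_eq: "d x (h x y) = d y (h x y)" "h x y \<le> k - 1" if "x < N" "y < N" for x y
    using that top unfolding h_def by (auto intro: LeastI[of _ "k - 1"] Least_le)
  have h_neq: "d x j \<noteq> d y j" if "j < h x y" for x y j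
    using that not_less_Least unfolding h_def by blast
  have d_mono: "d x j \<le> d y j" if "x < y" for x y j
    using that by (simp add: d_def div_le_mono)
  have d_Suc: "d x (Suc j) = d x j div l" for x j
    by (simp add: d_def div_mult2_eq[symmetric] algebra_simps)
  have "tournament N T" by (auto simp: tournament_def T_def)
  moreover have "k_colouring k T col"
    unfolding k_colouring_def
  proof (intro allI impI)
    fix x y assume "T x y"
    then have "h x y \<le> k - 1" using h_eq(2)[of x y] by (simp add: T_def)
    then show "col x y \<in> {1..k}" using assms(4) by (auto simp: col_def)
  qed
  moreover have "\<not> mono_copy N T col P"
  proof
    assume "mono_copy N T col P"
    then obtain v c where v: "inj_on v {0..n}" "v ` {0..n} \<subseteq> {0..<N}"
      and e: "\<And>i. i < n \<Longrightarrow> if P ! i then T (v i) (v (Suc i)) \<and> col (v i) (v (Suc i)) = c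
            else T (v (Suc i)) (v i) \<and> col (v (Suc i)) (v i) = c"
      unfolding mono_copy_def assms(1) by blast
    \<comment> \<open>An edge of colour \<open>Suc j\<close> preserves the part above digit
      \<open>j\<close> and strictly raises every longer truncation.\<close>
    have T_digit: "d x j = d y j" "i < j \<Longrightarrow> d x i < d y i" if "T x y" "col x y = Suc j" for x y i j
      using that h_eq(1)[of x y] h_neq[of i x y] d_mono[of x y i]
      by (auto simp: T_def col_def le_less)
    have "c \<noteq> 0" using e[of 0] assms(2) by (auto simp: col_def split: if_splits)
    then consider "c = Suc 0" | j where "c = Suc (Suc j)" by (metis not0_implies_Suc)
    then show False
    proof cases
      case 1
      \<comment> \<open>All \<open>n + 1\<close> vertices share their quotient by \<open>n\<close>,
        but only \<open>n\<close> numbers do.\<close>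
      have block: "i \<le> n \<Longrightarrow> d (v i) 0 = d (v 0) 0" for i
      proof (induction i)
        case (Suc i)
        then show ?case using e[of i] T_digit(1) 1 by (auto split: if_splits)
      qed simp
      then have "v i \<in> {n * d (v 0) 0..<n * d (v 0) 0 + n}" if "i \<le> n" for i
      proof -
        have "v i div n = d (v 0) 0" using block[OF that] by (simp add: d_def)
        moreover have "v i = n * (v i div n) + v i mod n" "v i mod n < n" using assms(2) by auto
        ultimately show ?thesis by (metis atLeastLessThan_iff le_add1 nat_add_left_cancel_less)
      qed
      then have "v ` {0..n} \<subseteq> {n * d (v 0) 0..<n * d (v 0) 0 + n}" by auto
      from card_mono[OF _ this] have "card (v ` {0..n}) \<le> n" by simp
      then show False using v by (simp add: card_image)
    next
      case 2
      \<comment> \<open>Along a longest directed run, \<open>d\<close> at index \<open>j\<close>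
        rises at each of \<open>l\<close> edges while its quotient by \<open>l\<close> is
        constant.\<close>
      obtain i where i: "i + l \<le> n" "\<And>t. i \<le> t \<and> t < i + l \<Longrightarrow> P ! t = P ! i"
        using longest_dir_attained[of P] assms by blast
      show False
      proof (cases "P ! i")
        case True
        have step: "T (v (i + t)) (v (Suc (i + t))) \<and> col (v (i + t)) (v (Suc (i + t))) = c"
          if "t < l" for t
          using e[of "i + t"] i that True by simp
        show False
          by (rule digit_bound[of l "\<lambda>t. d (v (i + t)) j"])
            (use step T_digit 2 l1 in \<open>auto simp flip: d_Suc\<close>)
      next
        case False
        \<comment> \<open>A backward run is traversed from its far end, so that values
          increase.\<close>
        have step: "T (v (i + (l - t))) (v (i + (l - Suc t))) \<and>
            col (v (i + (l - t))) (v (i + (l - Suc t))) = c" if "t < l" for t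
          using e[of "i + (l - Suc t)"] i(1) i(2)[of "i + (l - Suc t)"] that False
          by (simp add: Suc_diff_Suc flip: add_Suc_right)
        show False
          by (rule digit_bound[of l "\<lambda>t. d (v (i + (l - t))) j"])
            (use step T_digit 2 l1 in \<open>auto simp flip: d_Suc\<close>)
      qed
    qed
  qed
  ultimately show ?thesis by blast
qed

section \<open>Transfer to tournaments and the Ramsey number\<close>

lemma tournament_mono_copy:
  assumes "length P = n" "n \<ge> 1" "k \<ge> 1" "N = 8 ^ k * fact k * n * longest_dir P ^ (k - 1)"
    and T: "tournament N T" "k_colouring k T col"
  shows "mono_copy N T col P"
proof -
  have "longest_dir P \<le> n" using longest_dir_attained[of P] assms by auto
  moreover have "1 \<le> longest_dir P" using assms longest_dir_pos[of P] by fastforce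
  moreover have "Suc (k - 1) = k" using assms by simp
  moreover have "T x y \<or> T y x" if "x \<in> {0..<N}" "y \<in> {0..<N}" "x \<noteq> y" for x y
    using T(1) that unfolding tournament_def atLeastLessThan_iff by blast
  moreover have "\<not> T x x" if "x \<in> {0..<N}" for x
    using T(1) that unfolding tournament_def atLeastLessThan_iff by blast
  moreover have "col x y \<in> {1..k}" if "T x y" for x y
    using T(2) that unfolding k_colouring_def by blast
  ultimately have "\<exists>c\<in>{1..k}. \<exists>x ys. length ys = length P \<and> distinct (x # ys) \<and> set (x # ys) \<subseteq> {0..<N}
    \<and> follows (\<lambda>x y. T x y \<and> col x y = c) x P ys"
    using assms run_le_longest_dir
    by (intro mono_path[where l = "longest_dir P" and k = "k - 1" and n = n]) auto
  then obtain c x ys where ys: "length ys = length P" "distinct (x # ys)" "set (x # ys) \<subseteq> {0..<N}"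
    "follows (\<lambda>x y. T x y \<and> col x y = c) x P ys" by blast
  have "inj_on ((!) (x # ys)) {0..length P}"
    using ys by (intro inj_on_nth) auto
  moreover have "(!) (x # ys) ` {0..length P} \<subseteq> {0..<N}"
  proof (rule image_subsetI)
    fix i assume "i \<in> {0..length P}"
    then have "(x # ys) ! i \<in> set (x # ys)" using ys(1) by (intro nth_mem) auto
    then show "(x # ys) ! i \<in> {0..<N}" using ys(3) by blast
  qed
  moreover have "if P ! i then T ((x # ys) ! i) ((x # ys) ! Suc i) \<and> col ((x # ys) ! i) ((x # ys) ! Suc i) = c
      else T ((x # ys) ! Suc i) ((x # ys) ! i) \<and> col ((x # ys) ! Suc i) ((x # ys) ! i) = c"
    if "i < length P" for i
    using follows_nth[OF ys(4) that] by (simp add: edge_dir_def)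
  ultimately show ?thesis unfolding mono_copy_def by blast
qed

theorem theorem2:
  fixes P :: "bool list" and k n :: nat
  assumes "k \<ge> 1" and "length P = n" and "n \<ge> 1"
  shows "n * longest_dir P ^ (k - 1) \<le> RT P k \<and>
         RT P k \<le> 8 ^ k * fact k * n * longest_dir P ^ (k - 1)"
proof -
  let ?Q = "\<lambda>N. \<forall>T col. tournament N T \<and> k_colouring k T col \<longrightarrow> mono_copy N T col P"
  have Q: "?Q (8 ^ k * fact k * n * longest_dir P ^ (k - 1))"
    using tournament_mono_copy assms by blast
  \<comment> \<open>The lower bound also relies on this existence: without a witness the
    \<open>LEAST\<close> would be unspecified.\<close>
  then have "?Q (RT P k)" unfolding RT_def by (rule LeastI)
  then have "\<not> RT P k \<le> n * longest_dir P ^ (k - 1)"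
    using digit_colouring_no_copy[OF assms(2,3) refl assms(1)] by blast
  moreover have "RT P k \<le> 8 ^ k * fact k * n * longest_dir P ^ (k - 1)"
    unfolding RT_def using Q by (rule Least_le)
  ultimately show ?thesis by simp
qed

end
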